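(* Let $n$ be a positive integer and let $R$ be the tournament on $\mathbb{Z}_{2n+1}$ defined by: for $p, q \in \mathbb{Z}_{2n+1}$, $p \to q$ if and only if $q - p$ (mod $2n+1$) lies in $[n]$. There exists a proper, stratified $2n+1$ partition $\mathcal{A} = \{A_0, A_1, \dots, A_{2n}\}$ of $[3(2n+1)]$ with $R[\mathcal{A}] = R$. That is, for $p, q \in \mathbb{Z}_{2n+1}$, $$A_p \to A_q \quad \Longleftrightarrow \quad q - p \in [n] \ \text{mod} \ 2n+1.$$
   Context: For a positive integer $m$, $[m] = \{1, \dots, m\}$, and $\mathbb{Z}_{2n+1}$ is the additive group of integers mod $2n+1$, with congruence classes labeled $0, 1, \dots, 2n$; $[n]$ is regarded as the subset $\{1, \dots, n\}$ of $\mathbb{Z}_{2n+1}$. (The tournament $R$ is the group game on $\mathbb{Z}_{2n+1}$ with game subset $[n]$.) For a tournament, $p \to q$ means $(p,q) \in R$. Put $m = 2n+1$. An $m$ partition of $[3m]$ is here a family $\mathcal{A} = \{A_0, \dots, A_{2n}\}$, indexed by $\mathbb{Z}_{2n+1}$ instead of by $[2n+1]$, of pairwise disjoint subsets of $[3m]$ with union $[3m]$ and $|A_p| = 3$ for all $p$. Write $A_p \to A_q$ when $|\{(a,b) \in A_p \times A_q : a > b\}| > 9/2$, and $R[\mathcal{A}] = \{(p,q) : A_p \to A_q\}$. The partition is proper if the sums of the elements of $A_p$ are equal for all $p$ (so each sum equals $\frac{3(3m+1)}{2}$). Writing $A_p = \{a^p_1 < a^p_2 < a^p_3\}$, the partition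 is stratified if for each $s \in \{1,2,3\}$ the set $\{a^p_s : p \in \mathbb{Z}_{2n+1}\}$ equals $\{m(s-1) + j : j \in [m]\}$. *)

theory Defs
  imports Complex_Main "HOL-Library.Disjoint_Sets"
begin

text \<open>
  The group of integers mod \<open>m\<close> is represented by its labels \<open>0, \<dots>, m - 1\<close>, as integers,
  with differences reduced by \<open>mod m\<close>. A family indexed by this group is a function on \<open>int\<close>
  whose values outside these labels are irrelevant.
\<close>

definition labels :: "nat \<Rightarrow> int set" where
  "labels m = {0..<int m}"

definition is_tournament :: "'a set \<Rightarrow> ('a \<times> 'a) set \<Rightarrow> bool" where
  "is_tournament V E \<longleftrightarrow> E \<subseteq> V \<times> V \<and> (\<forall>p\<in>V. (p, p) \<notin> E) \<and>
     (\<forall>p\<in>V. \<forall>q\<in>V. p \<noteq> q \<longrightarrow> ((p, q) \<in> E \<longleftrightarrow> (q, p) \<notin> E))"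

definition game_tournament :: "nat \<Rightarrow> (int \<times> int) set" where
  "game_tournament n = {(p, q) \<in> labels (2 * n + 1) \<times> labels (2 * n + 1).
     (q - p) mod int (2 * n + 1) \<in> {1..int n}}"

definition triple_partition :: "nat \<Rightarrow> (int \<Rightarrow> nat set) \<Rightarrow> bool" where
  "triple_partition m A \<longleftrightarrow> disjoint_family_on A (labels m) \<and>
     (\<Union>p\<in>labels m. A p) = {1..3 * m} \<and> (\<forall>p\<in>labels m. card (A p) = 3)"

definition beats :: "nat set \<Rightarrow> nat set \<Rightarrow> bool" where
  "beats A B \<longleftrightarrow> real (card {(a, b) \<in> A \<times> B. a > b}) > 9 / 2"

definition partition_digraph :: "nat \<Rightarrow> (int \<Rightarrow> nat set) \<Rightarrow> (int \<times> int) set" where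
  "partition_digraph m A = {(p, q) \<in> labels m \<times> labels m. beats (A p) (A q)}"

definition proper :: "nat \<Rightarrow> (int \<Rightarrow> nat set) \<Rightarrow> bool" where
  "proper m A \<longleftrightarrow> (\<forall>p\<in>labels m. \<forall>q\<in>labels m. \<Sum>(A p) = \<Sum>(A q))"

text \<open>The \<open>s\<close>-th smallest element of a finite set, counting from \<open>s = 1\<close>.\<close>

definition nth_smallest :: "nat set \<Rightarrow> nat \<Rightarrow> nat" where
  "nth_smallest B s = sorted_list_of_set B ! (s - 1)"

definition stratified :: "nat \<Rightarrow> (int \<Rightarrow> nat set) \<Rightarrow> bool" where
  "stratified m A \<longleftrightarrow> (\<forall>s\<in>{1..3}.
     {nth_smallest (A p) s | p. p \<in> labels m} = {m * (s - 1) + j | j. j \<in> {1..m}})"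

lemma game_tournament_is_tournament:
  "is_tournament (labels (2 * n + 1)) (game_tournament n)"
proof -
  have m: "(q - p) mod int (2 * n + 1) = (if p \<le> q then q - p else q - p + int (2 * n + 1))"
    if "p \<in> labels (2 * n + 1)" "q \<in> labels (2 * n + 1)" for p q
  proof (cases "p \<le> q")
    case True
    then show ?thesis using that by (simp add: labels_def)
  next
    case False
    have "(q - p) mod int (2 * n + 1) = (q - p + int (2 * n + 1)) mod int (2 * n + 1)"
      by (rule mod_add_self2[symmetric])
    also have "\<dots> = q - p + int (2 * n + 1)"
      by (rule mod_pos_pos_trivial) (use that False in \<open>auto simp: labels_def\<close>)
    finally show ?thesis using False by simp
  qed
  have iff: "(p, q) \<in> game_tournament n \<longleftrightarrow> (q, p) \<notin> game_tournament n"
    if "p \<in> labels (2 * n + 1)" "q \<in> labels (2 * n + 1)" "p \<noteq> q" for p q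
    using that m[OF that(1,2)] m[OF that(2,1)]
    by (cases "p < q") (auto simp: game_tournament_def labels_def)
  show ?thesis
    unfolding is_tournament_def using iff by (auto simp: game_tournament_def)
qed

end

theory Submission
  imports Defs
begin

text \<open>
  A stratified family is given by three bijections \<open>f, g, h\<close> from the labels onto \<open>{1..m}\<close>, the
  ranks in the three strata. The three comparisons between different strata cancel out, so
  \<open>A p\<close> beats \<open>A q\<close> iff \<open>p\<close> outranks \<open>q\<close> under at least two of \<open>f, g, h\<close>. For \<open>m = 2 n + 1\<close> take
  \<open>f\<close> decreasing, \<open>g\<close> decreasing with slope \<open>-1\<close> on each of \<open>{0..n}\<close> and \<open>{n+1..2 n}\<close>
  (the second block on top), and \<open>h\<close> increasing with slope \<open>2\<close> on each block, through the odd
  and then the even ranks. Slopes add up to zero, and so do the jumps. For \<open>p < q\<close> in the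
  same block, \<open>p\<close> wins under \<open>f, g\<close>; in different blocks, \<open>f\<close> favours \<open>p\<close>, \<open>g\<close> favours \<open>q\<close>, and
  \<open>h\<close> favours \<open>p\<close> exactly when \<open>q - p \<le> n\<close>.
\<close>

definition strata_family :: "nat \<Rightarrow> (int \<Rightarrow> nat) \<Rightarrow> (int \<Rightarrow> nat) \<Rightarrow> (int \<Rightarrow> nat) \<Rightarrow> int \<Rightarrow> nat set" where
  "strata_family m f g h p = {f p, m + g p, 2 * m + h p}"

lemma card_labels: "card (labels m) = m"
  by (simp add: labels_def)

lemma bij_betw_labelsI:
  assumes "inj_on f (labels m)" "f ` labels m \<subseteq> {1..m}"
  shows "bij_betw f (labels m) {1..m}"
proof -
  have "f ` labels m = {1..m}"
    by (rule card_subset_eq) (use assms in \<open>simp_all add: card_image card_labels\<close>)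
  with assms(1) show ?thesis
    by (simp add: bij_betw_def)
qed

text \<open>The hypotheses put a lower-index entry of either triple below a higher-index entry of
  the other. Of the nine pairs, the three with index of \<open>a\<close> above that of
  \<open>b\<close> always count, their mirror images never; three equal-index pairs remain.\<close>

lemma card_greater_pairs_triples:
  fixes x1 x2 x3 y1 y2 y3 :: nat
  assumes "x1 < x2" "x2 < x3" "y1 < y2" "y2 < y3" "x1 < y2" "x2 < y3" "y1 < x2" "y2 < x3"
  shows "card {(a, b) \<in> {x1, x2, x3} \<times> {y1, y2, y3}. a > b} =
    3 + of_bool (x1 > y1) + of_bool (x2 > y2) + of_bool (x3 > y3)"
proof -
  let ?S = "{x1, x2, x3} \<times> {y1, y2, y3}"
  have "card {(a, b) \<in> ?S. a > b} = card {z \<in> ?S. snd z < fst z}"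
    by (rule arg_cong[where f = card]) auto
  also have "\<dots> = (\<Sum>z\<in>?S. of_bool (snd z < fst z))"
    by (simp add: Int_def)
  also have "\<dots> = (\<Sum>a\<in>{x1, x2, x3}. \<Sum>b\<in>{y1, y2, y3}. of_bool (b < a))"
    by (simp only: sum.cartesian_product case_prod_unfold)
  also have "\<dots> = 3 + of_bool (x1 > y1) + of_bool (x2 > y2) + of_bool (x3 > y3)"
    using assms by simp
  finally show ?thesis .
qed

context
  fixes m :: nat and f g h :: "int \<Rightarrow> nat"
  assumes bij: "bij_betw f (labels m) {1..m}" "bij_betw g (labels m) {1..m}"
    "bij_betw h (labels m) {1..m}"
begin

lemma rank_bounds:
  assumes "p \<in> labels m"
  shows "f p \<in> {1..m}" "g p \<in> {1..m}" "h p \<in> {1..m}"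
  using bij assms by (simp_all only: bij_betw_apply)

lemma beats_strata_family_iff:
  assumes "p \<in> labels m" "q \<in> labels m"
  shows "beats (strata_family m f g h p) (strata_family m f g h q) \<longleftrightarrow>
    of_bool (f p > f q) + of_bool (g p > g q) + of_bool (h p > h q) \<ge> (2 :: nat)"
proof -
  have "card {(a, b) \<in> strata_family m f g h p \<times> strata_family m f g h q. a > b} =
      3 + of_bool (f p > f q) + of_bool (g p > g q) + of_bool (h p > h q)"
    unfolding strata_family_def
    by (subst card_greater_pairs_triples)
       (use rank_bounds[OF assms(1)] rank_bounds[OF assms(2)] in auto)
  \<comment> \<open>With \<open>k\<close> strata won, \<open>3 + k > 9/2\<close> means
    \<open>k \<ge> 2\<close>, as \<open>k\<close> is an integer.\<close>
  then show ?thesis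
    by (auto simp: beats_def)
qed

lemma sum_strata_family:
  assumes "p \<in> labels m"
  shows "\<Sum>(strata_family m f g h p) = f p + g p + h p + 3 * m"
  using rank_bounds[OF assms] by (simp add: strata_family_def)

lemma nth_smallest_strata_family:
  assumes "p \<in> labels m"
  shows "nth_smallest (strata_family m f g h p) 1 = f p"
    "nth_smallest (strata_family m f g h p) 2 = m + g p"
    "nth_smallest (strata_family m f g h p) 3 = 2 * m + h p"
proof -
  \<comment> \<open>The list is increasing:
    \<open>f p \<le> m < m + g p \<le> 2 * m < 2 * m + h p\<close>.\<close>
  have "sorted_list_of_set (set [f p, m + g p, 2 * m + h p]) = [f p, m + g p, 2 * m + h p]"
    by (rule sorted_list_of_set.idem_if_sorted_distinct) (use rank_bounds[OF assms] in auto)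
  then have "sorted_list_of_set (strata_family m f g h p) = [f p, m + g p, 2 * m + h p]"
    by (simp only: strata_family_def list.set)
  then show "nth_smallest (strata_family m f g h p) 1 = f p"
    "nth_smallest (strata_family m f g h p) 2 = m + g p"
    "nth_smallest (strata_family m f g h p) 3 = 2 * m + h p"
    by (simp_all add: nth_smallest_def)
qed

lemma stratified_strata_family: "stratified m (strata_family m f g h)"
proof -
  have im: "{c + r p | p. p \<in> labels m} = {c + j | j. j \<in> {1..m}}"
    if "bij_betw r (labels m) {1..m}" for r :: "int \<Rightarrow> nat" and c
    unfolding bij_betw_imp_surj_on[OF that, symmetric] by blast
  have "{nth_smallest (strata_family m f g h p) s | p. p \<in> labels m} =
      {m * (s - 1) + j | j. j \<in> {1..m}}" if "s \<in> {1..3}" for s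
  proof -
    from that consider "s = 1" | "s = 2" | "s = 3" by force
    then show ?thesis
    proof cases
      case 1
      then show ?thesis
        using im[OF bij(1), of 0] nth_smallest_strata_family(1) by (auto simp: set_eq_iff) metis+
    next
      case 2
      then show ?thesis
        using im[OF bij(2), of m] nth_smallest_strata_family(2) by (auto simp: set_eq_iff) metis+
    next
      case 3
      then show ?thesis
        using im[OF bij(3), of "2 * m"] nth_smallest_strata_family(3)
        by (auto simp: set_eq_iff mult.commute) metis+
    qed
  qed
  then show ?thesis
    by (simp add: stratified_def)
qed

lemma triple_partition_strata_family: "triple_partition m (strata_family m f g h)"
  unfolding triple_partition_def
proof (intro conjI ballI)
  show "disjoint_family_on (strata_family m f g h) (labels m)"
    unfolding disjoint_family_on_def
  proof (intro ballI impI)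
    fix p q assume pq: "p \<in> labels m" "q \<in> labels m" "p \<noteq> q"
    then have "f p \<noteq> f q" "g p \<noteq> g q" "h p \<noteq> h q"
      using bij by (auto simp: bij_betw_def dest: inj_onD)
    then show "strata_family m f g h p \<inter> strata_family m f g h q = {}"
      using rank_bounds[OF pq(1)] rank_bounds[OF pq(2)] by (auto simp: strata_family_def)
  qed
  have "(\<Union>p\<in>labels m. strata_family m f g h p) =
      f ` labels m \<union> (+) m ` g ` labels m \<union> (+) (2 * m) ` h ` labels m"
    by (auto simp: strata_family_def)
  also have "\<dots> = {1..m} \<union> {m + 1..m + m} \<union> {2 * m + 1..2 * m + m}"
    using bij by (simp add: bij_betw_def)
  also have "\<dots> = {1..3 * m}"
    by auto
  finally show "(\<Union>p\<in>labels m. strata_family m f g h p) = {1..3 * m}" .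
next
  fix p assume "p \<in> labels m"
  from rank_bounds[OF this] show "card (strata_family m f g h p) = 3"
    by (simp add: strata_family_def)
qed

end

lemma diff_mod_labels:
  assumes "p \<in> labels m" "q \<in> labels m"
  shows "(q - p) mod int m = (if p \<le> q then q - p else q - p + int m)"
proof (cases "p \<le> q")
  case True
  then show ?thesis using assms by (simp add: labels_def)
next
  case False
  have "(q - p) mod int m = (q - p + int m) mod int m"
    by simp
  also have "\<dots> = q - p + int m"
    by (rule mod_pos_pos_trivial) (use assms False in \<open>auto simp: labels_def\<close>)
  finally show ?thesis using False by simp
qed

theorem theorem4p4:
  fixes n :: nat
  assumes "n > 0"
  shows "\<exists>A :: int \<Rightarrow> nat set.
    triple_partition (2 * n + 1) A \<and> proper (2 * n + 1) A \<and> stratified (2 * n + 1) A \<and>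
    partition_digraph (2 * n + 1) A = game_tournament n \<and>
    (\<forall>p\<in>labels (2 * n + 1). \<forall>q\<in>labels (2 * n + 1).
       beats (A p) (A q) \<longleftrightarrow> (q - p) mod int (2 * n + 1) \<in> {1..int n})"
proof -
  define m where "m = 2 * n + 1"
  define f where "f p = nat (2 * int n + 1 - p)" for p
  define g where "g p = nat (if p \<le> int n then int n + 1 - p else 3 * int n + 2 - p)" for p
  \<comment> \<open>For \<open>p \<le> n < q\<close>, \<open>2 * p + 1 > 2 * q - 2 * n\<close> holds
    iff \<open>q - p \<le> n\<close>, by parity.\<close>
  define h where "h p = nat (if p \<le> int n then 2 * p + 1 else 2 * p - 2 * int n)" for p
  define A where "A = strata_family m f g h"
  have "bij_betw f (labels m) {1..m}"
    by (rule bij_betw_labelsI) (auto simp: inj_on_def f_def labels_def m_def)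
  moreover have "bij_betw g (labels m) {1..m}"
    by (rule bij_betw_labelsI) (auto simp: inj_on_def g_def labels_def m_def split: if_splits)
  moreover have "bij_betw h (labels m) {1..m}"
  proof (rule bij_betw_labelsI)
    show "inj_on h (labels m)"
      \<comment> \<open>Ranks from different blocks differ in parity.\<close>
      unfolding inj_on_def h_def labels_def m_def by (auto simp: eq_nat_nat_iff split: if_splits) presburger+
    show "h ` labels m \<subseteq> {1..m}"
      by (auto simp: h_def labels_def m_def)
  qed
  ultimately have bij: "bij_betw f (labels m) {1..m}" "bij_betw g (labels m) {1..m}"
    "bij_betw h (labels m) {1..m}" .
  \<comment> \<open>The three ranks add up to \<open>3 * n + 3\<close> on either block, three times
    the mean rank \<open>n + 1\<close>.\<close>
  have "\<Sum>(A p) = 3 * n + 3 + 3 * m" if "p \<in> labels m" for p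
    using that unfolding A_def sum_strata_family[OF bij that]
    by (auto simp: f_def g_def h_def labels_def m_def)
  then have "proper m A"
    by (simp add: proper_def)
  \<comment> \<open>For \<open>q < p\<close> the residue \<open>q - p + m\<close> lies in
    \<open>{1..n}\<close> iff \<open>p - q \<ge> n + 1\<close>. This forces different blocks, where
    \<open>h\<close> favours \<open>p\<close> under exactly this condition.\<close>
  moreover have beats: "beats (A p) (A q) \<longleftrightarrow> (q - p) mod int m \<in> {1..int n}"
    if "p \<in> labels m" "q \<in> labels m" for p q
    using that unfolding A_def beats_strata_family_iff[OF bij that] diff_mod_labels[OF that]
    by (auto simp: f_def g_def h_def labels_def m_def)
  moreover from beats have "partition_digraph m A = game_tournament n"
    unfolding partition_digraph_def game_tournament_def m_def[symmetric] by auto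
  ultimately show ?thesis
    using triple_partition_strata_family[OF bij] stratified_strata_family[OF bij]
    unfolding A_def m_def by blast
qed

end
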